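(* There is an absolute constant $c>0$ such that for all positive integers $n$ and $k$ with $k\le n$ and every deterministic robot strategy $R$ for making $k$ trips, the cumulative $k$-trip competitive ratio satisfies $\rho(R,n,k)\ge c\sqrt{n/k}$; that is, $\rho(R,n,k)=\Omega(\sqrt{n/k})$.
   Context: Model ("wall problem"): the plane contains a finite collection of non-overlapping axis-parallel rectangular obstacles, each of width and height at least $1$, with the $x$-coordinates of all obstacle corners integral. The start point is $s=(0,0)$ and the target $t$ is the vertical line $x=n$; a trip from $s$ to $t$ ends when the robot reaches any point of this line (trips alternate between going from $s$ to $t$ and back). Obstacles that touch may be passed between (the point robot can squeeze between them). Such an arrangement is a scene; $\mathcal S(n)$ denotes the class of all such scenes with parameter $n$. The robot is a point that always knows its own position and the target, but does not know the obstacles in advance: it learns of an obstacle only upon touching it, at which time it is told which corner of that rectangle is nearest to it and the distance to that corner; it retains all information gathered on earlier trips. For a strategy $R$ and scene $S$, $R_i(S)$ is the length of the robot's path on the $i$-th trip, $R^{(k)}(S)=\sum_{i=1}^k R_i(S)$, and $L(S)$ is the length of a shortest obstacle-avoiding path from $s$ to $t$ in $S$. The cumulative $k$-trip competitive ratio is $\rho(R,n,k)=\max_{S\in\mathcal S(n)} R^{(k)}(S)/(k\,L(S))$. *)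

theory Defs
  imports "HOL-Analysis.Analysis"
begin

type_synonym point = "real \<times> real"

text \<open>An obstacle is an axis-parallel rectangle [x1,x2] x [y1,y2], encoded as (x1,x2,y1,y2).\<close>
type_synonym obstacle = "real \<times> real \<times> real \<times> real"
type_synonym scene = "obstacle set"

definition rect :: "obstacle \<Rightarrow> point set" where
  "rect ob = (case ob of (x1,x2,y1,y2) \<Rightarrow> {x1..x2} \<times> {y1..y2})"

definition rect_int :: "obstacle \<Rightarrow> point set" where
  "rect_int ob = (case ob of (x1,x2,y1,y2) \<Rightarrow> {x1<..<x2} \<times> {y1<..<y2})"

definition well_formed_obstacle :: "obstacle \<Rightarrow> bool" where
  "well_formed_obstacle ob = (case ob of (x1,x2,y1,y2) \<Rightarrow>
      x2 - x1 \<ge> 1 \<and> y2 - y1 \<ge> 1 \<and> x1 \<in> \<int> \<and> x2 \<in> \<int>)"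

definition start_point :: point where "start_point = (0,0)"

definition scenes :: "nat \<Rightarrow> scene set" where
  "scenes n = {S. finite S \<and> (\<forall>ob\<in>S. well_formed_obstacle ob)
     \<and> (\<forall>ob\<in>S. \<forall>ob'\<in>S. ob \<noteq> ob' \<longrightarrow> rect_int ob \<inter> rect_int ob' = {})
     \<and> (\<forall>ob\<in>S. start_point \<notin> rect_int ob)}"

definition free :: "scene \<Rightarrow> point set" where
  "free S = UNIV - (\<Union>ob\<in>S. rect_int ob)"

definition corner :: "obstacle \<Rightarrow> bool \<times> bool \<Rightarrow> point" where
  "corner ob l = (case ob of (x1,x2,y1,y2) \<Rightarrow>
      ((if fst l then x2 else x1), (if snd l then y2 else y1)))"

definition corner_dist :: "obstacle \<Rightarrow> point \<Rightarrow> real" where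
  "corner_dist ob p = Min ((\<lambda>l. dist p (corner ob l)) ` UNIV)"

definition touch_info :: "obstacle \<Rightarrow> point \<Rightarrow> (bool \<times> bool) set \<times> real" where
  "touch_info ob p = ({l. dist p (corner ob l) = corner_dist ob p}, corner_dist ob p)"

definition obs :: "scene \<Rightarrow> point \<Rightarrow> ((bool \<times> bool) set \<times> real) set" where
  "obs S p = (\<lambda>ob. touch_info ob p) ` {ob\<in>S. p \<in> rect ob}"

definition curve_length :: "(real \<Rightarrow> point) \<Rightarrow> real \<Rightarrow> real \<Rightarrow> ereal" where
  "curve_length g a b = Sup {ereal (\<Sum>i<m. dist (g (ts i)) (g (ts (Suc i)))) | m ts.
      ts 0 = a \<and> ts m = b \<and> (\<forall>i<m. ts i \<le> ts (Suc i))}"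

definition shortest :: "nat \<Rightarrow> scene \<Rightarrow> ereal" where
  "shortest n S = Inf {curve_length g 0 1 | g. path g \<and> pathstart g = start_point
      \<and> fst (pathfinish g) = real n \<and> path_image g \<subseteq> free S}"

text \<open>Goal of trip i (i \<ge> 1): odd trips go to the line x = n, even trips back to s.\<close>
definition trip_goal :: "nat \<Rightarrow> nat \<Rightarrow> point set" where
  "trip_goal n i = (if odd i then {p. fst p = real n} else {start_point})"

fun trip_end :: "nat \<Rightarrow> (real \<Rightarrow> point) \<Rightarrow> nat \<Rightarrow> real option" where
  "trip_end n g 0 = Some 0"
| "trip_end n g (Suc i) = (case trip_end n g i of None \<Rightarrow> None
     | Some a \<Rightarrow> (if \<exists>t\<ge>a. g t \<in> trip_goal n (Suc i)
                  then Some (Inf {t. t \<ge> a \<and> g t \<in> trip_goal n (Suc i)}) else None))"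

text \<open>A deterministic online strategy: for each scene the robot's trajectory (time \<ge> 0),
 continuous, starting at s, avoiding obstacles, and non-anticipating: it depends only on the
 information received along the way.\<close>
definition strategy :: "nat \<Rightarrow> (scene \<Rightarrow> real \<Rightarrow> point) \<Rightarrow> bool" where
  "strategy n R =
    ((\<forall>S\<in>scenes n. continuous_on {0..} (R S) \<and> R S 0 = start_point
        \<and> (\<forall>t\<ge>0. R S t \<in> free S))
     \<and> (\<forall>S\<in>scenes n. \<forall>S'\<in>scenes n. \<forall>t\<ge>0.
          (\<forall>\<tau>\<in>{0..t}. obs S (R S \<tau>) = obs S' (R S \<tau>)) \<longrightarrow> (\<forall>\<tau>\<in>{0..t}. R S' \<tau> = R S \<tau>)))"

definition cum_cost :: "nat \<Rightarrow> (scene \<Rightarrow> real \<Rightarrow> point) \<Rightarrow> nat \<Rightarrow> scene \<Rightarrow> ereal" where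
  "cum_cost n R k S = (case trip_end n (R S) k of None \<Rightarrow> \<infinity>
                        | Some T \<Rightarrow> curve_length (R S) 0 T)"

definition comp_ratio :: "(scene \<Rightarrow> real \<Rightarrow> point) \<Rightarrow> nat \<Rightarrow> nat \<Rightarrow> ereal" where
  "comp_ratio R n k = Sup {cum_cost n R k S / (ereal (real k) * shortest n S) | S. S \<in> scenes n}"

end

theory Submission
  imports Defs
begin

text \<open>Let h = sqrt (n/k) and fill the strip between x = 0 and x = n with a brick wall: columns of
  width 1 cut into cells of height h, adjacent columns being shifted by h/2. Inside a column the robot
  can only use the crevices between cells, so passing from one column to the next costs h/2 and every
  trip costs at least of order nh. Now run the robot on the full wall until it has travelled about
  nkh/5, and let S consist of just those cells it has touched. It cannot tell S from the full wall, so
  it pays of order nkh in S. A connected piece of its path of diameter below h/2 touches at most six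
  cells, hence S has O(nk) cells. Each cell blocks at most one of the sqrt (nk) lowest levels lh, so
  some level is blocked O(sqrt (nk)) times; following it with detours of length h takes O(n).\<close>

section \<open>Lengths of curves\<close>

text \<open>A finite partition is kept as the witness of a lower bound on the length. Bounds can
  then grow vertex by vertex and depend only on the curve on \<open>{0..b}\<close>, which avoids
  additivity of \<open>curve_length\<close>.\<close>

definition polygonal_reach :: "(real \<Rightarrow> point) \<Rightarrow> real \<Rightarrow> real \<Rightarrow> bool" where
  "polygonal_reach g b v \<longleftrightarrow> (\<exists>m ts. ts 0 = 0 \<and> ts m = b \<and> (\<forall>i<m. ts i \<le> ts (Suc i)) \<and>
     v \<le> (\<Sum>i<m. dist (g (ts i)) (g (ts (Suc i)))))"

lemma polygonal_reach_0: "polygonal_reach g 0 0"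
  unfolding polygonal_reach_def by (rule exI[of _ 0]) auto

lemma polygonal_reach_step:
  assumes "polygonal_reach g b v" "b \<le> c" "w \<le> v + dist (g b) (g c)"
  shows "polygonal_reach g c w"
proof -
  obtain m ts where ts: "ts 0 = (0::real)" "ts m = b" "\<And>i. i < m \<Longrightarrow> ts i \<le> ts (Suc i)"
    "v \<le> (\<Sum>i<m. dist (g (ts i)) (g (ts (Suc i))))"
    using assms(1) unfolding polygonal_reach_def by auto
  define us where "us = ts(Suc m := c)"
  have "(\<Sum>i<Suc m. dist (g (us i)) (g (us (Suc i))))
      = (\<Sum>i<m. dist (g (ts i)) (g (ts (Suc i)))) + dist (g b) (g c)"
    using ts(2) by (auto simp: us_def intro!: sum.cong)
  then have "w \<le> (\<Sum>i<Suc m. dist (g (us i)) (g (us (Suc i))))"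
    using ts(4) assms(3) by linarith
  moreover have "us 0 = 0" "us (Suc m) = c" "\<forall>i<Suc m. us i \<le> us (Suc i)"
    using ts assms(2) by (auto simp: us_def less_Suc_eq)
  ultimately show ?thesis unfolding polygonal_reach_def by blast
qed

text \<open>Serves to carry a bound from the run on the full wall over to the run on the pruned
  scene.\<close>

lemma polygonal_reach_cong:
  assumes "polygonal_reach f b v" "\<And>t. t \<in> {0..b} \<Longrightarrow> f t = g t"
  shows "polygonal_reach g b v"
proof -
  obtain m ts where ts: "ts 0 = (0::real)" "ts m = b" "\<forall>i<m. ts i \<le> ts (Suc i)"
    "v \<le> (\<Sum>i<m. dist (f (ts i)) (f (ts (Suc i))))"
    using assms(1) unfolding polygonal_reach_def by auto
  have mono: "ts i \<le> ts j" if "i \<le> j" "j \<le> m" for i j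
    using that by (induction j) (use ts(3) in \<open>auto simp: le_Suc_eq intro: order_trans\<close>)
  have "f (ts i) = g (ts i)" if "i \<le> m" for i
    using mono[of 0 i] mono[of i m] that ts by (intro assms(2)) auto
  then have "(\<Sum>i<m. dist (f (ts i)) (f (ts (Suc i)))) = (\<Sum>i<m. dist (g (ts i)) (g (ts (Suc i))))"
    by (intro sum.cong) auto
  then show ?thesis using ts unfolding polygonal_reach_def by auto
qed

lemma polygonal_reach_curve_length:
  assumes "polygonal_reach g b v"
  shows "ereal v \<le> curve_length g 0 b"
proof -
  obtain m ts where ts: "ts 0 = (0::real)" "ts m = b" "\<forall>i<m. ts i \<le> ts (Suc i)"
    "v \<le> (\<Sum>i<m. dist (g (ts i)) (g (ts (Suc i))))"
    using assms unfolding polygonal_reach_def by auto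
  have "ereal (\<Sum>i<m. dist (g (ts i)) (g (ts (Suc i)))) \<le> curve_length g 0 b"
    unfolding curve_length_def by (rule Sup_upper) (use ts in blast)
  then show ?thesis using ts(4) by (meson ereal_less_eq(3) order_trans)
qed

lemma curve_length_le_lipschitz:
  assumes "B-lipschitz_on {a..b} g"
  shows "curve_length g a b \<le> ereal (B * (b - a))"
  unfolding curve_length_def
proof (rule Sup_least, clarify)
  fix m and ts :: "nat \<Rightarrow> real"
  assume ts: "\<forall>i<m. ts i \<le> ts (Suc i)" "a = ts 0" "b = ts m"
  have mono: "ts i \<le> ts j" if "i \<le> j" "j \<le> m" for i j
    using that by (induction j) (use ts(1) in \<open>auto simp: le_Suc_eq intro: order_trans\<close>)
  have "dist (g (ts i)) (g (ts (Suc i))) \<le> B * (ts (Suc i) - ts i)" if "i < m" for i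
    using lipschitz_onD[OF assms, of "ts i" "ts (Suc i)"] mono[of 0 i] mono[of i m]
      mono[of 0 "Suc i"] mono[of "Suc i" m] mono[of i "Suc i"] that ts
    by (auto simp: dist_real_def)
  then have "(\<Sum>i<m. dist (g (ts i)) (g (ts (Suc i)))) \<le> (\<Sum>i<m. B * (ts (Suc i) - ts i))"
    by (intro sum_mono) auto
  also have "\<dots> = B * (ts m - ts 0)"
    by (simp add: sum_distrib_left[symmetric] sum_lessThan_telescope)
  finally show "ereal (\<Sum>i<m. dist (g (ts i)) (g (ts (Suc i)))) \<le> ereal (B * (ts m - ts 0))"
    by simp
qed

text \<open>Walks are parametrised on the interval from 0 to B with speed at most 1, so that B bounds the
  length; this makes concatenation a matter of gluing Lipschitz functions.\<close>

definition walk :: "scene \<Rightarrow> point \<Rightarrow> point \<Rightarrow> real \<Rightarrow> bool" where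
  "walk S p q B \<longleftrightarrow> 0 \<le> B \<and> (\<exists>g. 1-lipschitz_on {0..B} g \<and> g 0 = p \<and> g B = q \<and> g ` {0..B} \<subseteq> free S)"

lemma walk_segment:
  assumes "closed_segment p q \<subseteq> free S" "dist p q \<le> B"
  shows "walk S p q B"
proof (cases "B = 0")
  case True
  then show ?thesis using assms unfolding walk_def
    by (auto intro!: exI[of _ "\<lambda>_. p"] simp: lipschitz_on_def)
next
  case False
  then have B: "B > 0" using assms(2) zero_le_dist[of p q] by linarith
  define g where "g t = linepath p q (t / B)" for t
  have "1-lipschitz_on {0..B} g"
  proof (rule lipschitz_onI)
    fix s t assume "s \<in> {0..B}" "t \<in> {0..B}"
    have "g s - g t = ((s - t) / B) *\<^sub>R (q - p)"
      by (simp add: g_def linepath_def algebra_simps diff_divide_distrib)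
    then have "dist (g s) (g t) = \<bar>s - t\<bar> * (dist p q / B)"
      using B by (simp add: dist_norm norm_minus_commute)
    also have "\<dots> \<le> \<bar>s - t\<bar> * 1"
      using assms(2) B by (intro mult_left_mono) auto
    finally show "dist (g s) (g t) \<le> 1 * dist s t" by (simp add: dist_real_def)
  qed simp
  moreover have "g ` {0..B} \<subseteq> closed_segment p q"
    using B by (auto simp: g_def linepath_in_path)
  moreover have "g 0 = p" "g B = q" using B by (auto simp: g_def linepath_def)
  ultimately show ?thesis unfolding walk_def using assms(1) B by fastforce
qed

lemma walk_trans:
  assumes "walk S p q A" "walk S q r B"
  shows "walk S p r (A + B)"
proof -
  obtain f where f: "1-lipschitz_on {0..A} f" "f 0 = p" "f A = q" "f ` {0..A} \<subseteq> free S" and A: "0 \<le> A"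
    using assms(1) unfolding walk_def by auto
  obtain g where g: "1-lipschitz_on {0..B} g" "g 0 = q" "g B = r" "g ` {0..B} \<subseteq> free S" and B: "0 \<le> B"
    using assms(2) unfolding walk_def by auto
  define k where "k t = (if t \<le> A then f t else g (t - A))" for t
  have "1-lipschitz_on {A..A + B} (\<lambda>t. g (t - A))"
  proof (rule lipschitz_onI)
    fix s t assume "s \<in> {A..A + B}" "t \<in> {A..A + B}"
    then show "dist (g (s - A)) (g (t - A)) \<le> 1 * dist s t"
      using lipschitz_onD[OF g(1), of "s - A" "t - A"] by (auto simp: dist_real_def)
  qed simp
  then have "1-lipschitz_on {0..A + B} k"
    unfolding k_def using f(1) by (intro lipschitz_on_concat) (auto simp: f g)
  moreover have "k ` {0..A + B} \<subseteq> free S"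
    using f(4) g(4) by (force simp: k_def)
  moreover have "k 0 = p" "k (A + B) = r"
    using A B f g by (auto simp: k_def)
  ultimately show ?thesis unfolding walk_def using A B by (intro conjI exI[of _ k]) auto
qed

lemma shortest_le_walk:
  assumes "walk S start_point q B" "fst q = real n"
  shows "shortest n S \<le> ereal B"
proof -
  obtain g where g: "1-lipschitz_on {0..B} g" "g 0 = start_point" "g B = q" "g ` {0..B} \<subseteq> free S" and B: "0 \<le> B"
    using assms(1) unfolding walk_def by auto
  define f where "f t = g (B * t)" for t
  have lip: "B-lipschitz_on {0..1} f"
  proof (rule lipschitz_onI)
    fix s t :: real assume "s \<in> {0..1}" "t \<in> {0..1}"
    then have "B * s \<in> {0..B}" "B * t \<in> {0..B}" using B by (auto simp: mult_left_le)
    then have "dist (f s) (f t) \<le> \<bar>B * s - B * t\<bar>"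
      using lipschitz_onD[OF g(1), of "B * s" "B * t"] by (auto simp: f_def dist_real_def)
    also have "\<dots> = B * dist s t"
      using B by (simp add: dist_real_def abs_mult flip: right_diff_distrib)
    finally show "dist (f s) (f t) \<le> B * dist s t" .
  qed fact
  have "path f" unfolding path_def using lip by (rule lipschitz_on_continuous_on)
  moreover have "path_image f \<subseteq> free S"
    using g(4) B by (fastforce simp: path_image_def f_def mult_left_le)
  moreover have "pathstart f = start_point" "fst (pathfinish f) = real n"
    using g assms(2) by (auto simp: pathstart_def pathfinish_def f_def)
  ultimately have "shortest n S \<le> curve_length f 0 1"
    unfolding shortest_def by (intro Inf_lower) blast
  also have "\<dots> \<le> ereal B" using curve_length_le_lipschitz[OF lip] by simp
  finally show ?thesis .
qed

lemma shortest_nonneg: "0 \<le> shortest n S"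
  unfolding shortest_def
proof (rule Inf_greatest, clarify)
  fix g :: "real \<Rightarrow> point"
  have "polygonal_reach g 1 0"
    by (rule polygonal_reach_step[OF polygonal_reach_0]) auto
  then show "0 \<le> curve_length g 0 1"
    using polygonal_reach_curve_length by (fastforce simp: zero_ereal_def)
qed

section \<open>The brick wall\<close>

text \<open>Column \<open>c\<close> is raised by \<open>c * h / 2\<close> instead of alternating
  between two positions. Up to integer shifts of \<open>j\<close> only the parity of
  \<open>c\<close> matters, so this is the usual brick pattern with one uniform formula.\<close>

definition cell :: "real \<Rightarrow> nat \<Rightarrow> int \<Rightarrow> obstacle" where
  "cell h c j = (real c, real c + 1, (of_int j + real c / 2) * h, (of_int j + 1 + real c / 2) * h)"

text \<open>Scenes are finite, so the wall is cut off at index \<open>J\<close>. The columns drift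
  upwards by less than \<open>n / 2\<close> cell heights, so
  \<open>M / h + real n \<le> of_int J\<close> makes it complete between the heights
  \<open>-M\<close> and \<open>M\<close>.\<close>

definition grid :: "real \<Rightarrow> nat \<Rightarrow> int \<Rightarrow> scene" where
  "grid h n J = (\<lambda>(c, j). cell h c j) ` ({..<n} \<times> {-J..J})"

lemma rect_int_cell:
  "h > 0 \<Longrightarrow> p \<in> rect_int (cell h c j) \<longleftrightarrow>
    real c < fst p \<and> fst p < real c + 1 \<and> of_int j < snd p / h - real c / 2 \<and> snd p / h - real c / 2 < of_int j + 1"
  by (cases p) (auto simp: rect_int_def cell_def field_simps)

lemma rect_cell:
  "h > 0 \<Longrightarrow> p \<in> rect (cell h c j) \<longleftrightarrow>
    real c \<le> fst p \<and> fst p \<le> real c + 1 \<and> of_int j \<le> snd p / h - real c / 2 \<and> snd p / h - real c / 2 \<le> of_int j + 1"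
  by (cases p) (auto simp: rect_def cell_def field_simps)

lemma grid_in_scenes:
  assumes "h \<ge> 1"
  shows "grid h n J \<in> scenes n"
proof -
  have "rect_int (cell h c j) \<inter> rect_int (cell h c' j') = {}" if "cell h c j \<noteq> cell h c' j'" for c j c' j'
  proof (rule ccontr)
    assume "\<not> ?thesis"
    then obtain p where "p \<in> rect_int (cell h c j)" "p \<in> rect_int (cell h c' j')" by blast
    then have p: "real c < fst p" "fst p < real c + 1" "real c' < fst p" "fst p < real c' + 1"
       "of_int j < snd p / h - real c / 2" "snd p / h - real c / 2 < of_int j + 1"
       "of_int j' < snd p / h - real c' / 2" "snd p / h - real c' / 2 < of_int j' + 1"
      using assms by (auto simp: rect_int_cell)
    then have "c = c'" by linarith
    with p have "j = j'" by linarith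
    with \<open>c = c'\<close> that show False by simp
  qed
  moreover have "start_point \<notin> rect_int (cell h c j)" for c j
    using assms by (auto simp: rect_int_cell start_point_def)
  moreover have "well_formed_obstacle (cell h c j)" for c j
    using assms by (auto simp: well_formed_obstacle_def cell_def algebra_simps)
  moreover have "finite (grid h n J)" by (simp add: grid_def)
  moreover have "\<exists>c j. ob = cell h c j" if "ob \<in> grid h n J" for ob
    using that by (auto simp: grid_def)
  ultimately show ?thesis
    unfolding scenes_def mem_Collect_eq by metis
qed

lemma scenes_subset: "S' \<in> scenes n \<Longrightarrow> S \<subseteq> S' \<Longrightarrow> S \<in> scenes n"
  unfolding scenes_def mem_Collect_eq by (meson finite_subset subsetD)

text \<open>Rounding the normalised height down gives the only cell of the column whose interior
  could contain \<open>p\<close>. The bound on \<open>J\<close> puts this cell into the wall, so a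
  free point must lie on its lower edge.\<close>

lemma free_grid_crevice:
  assumes "p \<in> free (grid h n J)" "h > 0" "c < n" "real c < fst p" "fst p < real c + 1"
    and "\<bar>snd p\<bar> \<le> M" "M / h + real n \<le> of_int J"
  obtains z :: int where "snd p = h * (of_int z + real c / 2)"
proof -
  define j where "j = \<lfloor>snd p / h - real c / 2\<rfloor>"
  have "\<bar>snd p / h\<bar> \<le> M / h" using assms(2,6) by (simp add: divide_right_mono)
  moreover have "real c + 1 \<le> real n" using assms(3) by linarith
  ultimately have "\<bar>snd p / h - real c / 2\<bar> \<le> of_int J - 1" using assms(7) by linarith
  then have "j \<in> {-J..J}" unfolding j_def by (auto; linarith)
  then have "cell h c j \<in> grid h n J" using assms(3) unfolding grid_def by force
  then have "p \<notin> rect_int (cell h c j)" using assms(1) unfolding free_def by auto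
  then have "snd p / h - real c / 2 = of_int j"
    using assms(2,4,5) unfolding rect_int_cell[OF assms(2)] j_def by linarith
  then have "snd p = h * (of_int j + real c / 2)" using assms(2) by (simp add: field_simps)
  then show thesis by (rule that)
qed

text \<open>Crevice heights are \<open>h / 2\<close> times an integer with the parity of the column
  index. In neighbouring columns they therefore differ by an odd, hence nonzero, multiple of
  \<open>h / 2\<close>.\<close>

lemma free_grid_adjacent_columns:
  assumes "p \<in> free (grid h n J)" "c < n" "real c < fst p" "fst p < real c + 1" "\<bar>snd p\<bar> \<le> M"
    and "q \<in> free (grid h n J)" "d < n" "real d < fst q" "fst q < real d + 1" "\<bar>snd q\<bar> \<le> M"
    and "c = Suc d \<or> d = Suc c" "h > 0" "M / h + real n \<le> of_int J"
  shows "h / 2 \<le> \<bar>snd p - snd q\<bar>"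
proof -
  obtain z :: int where z: "snd p = h * (of_int z + real c / 2)"
    by (rule free_grid_crevice[OF assms(1,12,2-5,13)])
  obtain w :: int where w: "snd q = h * (of_int w + real d / 2)"
    by (rule free_grid_crevice[OF assms(6,12,7-10,13)])
  have "snd p - snd q = h / 2 * of_int (2 * z - 2 * w + int c - int d)"
    using z w by (simp add: algebra_simps)
  then have "\<bar>snd p - snd q\<bar> = h / 2 * of_int \<bar>2 * z - 2 * w + int c - int d\<bar>"
    using assms(12) by (simp only: abs_mult of_int_abs)
  moreover have "1 \<le> \<bar>2 * z - 2 * w + int c - int d\<bar>" using assms(11) by presburger
  then have "(1::real) \<le> of_int \<bar>2 * z - 2 * w + int c - int d\<bar>" by linarith
  ultimately show ?thesis using assms(12) by (simp add: mult_le_cancel_left1)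
qed

text \<open>Reaching a fourth column would mean traversing the two middle ones, whose crevices are
  at least \<open>h / 2\<close> apart, while \<open>C\<close> has vertical extent at most
  \<open>2 * r < h / 2\<close>. Within one column such an extent meets at most two closed cells,
  which gives \<open>3 * 2\<close>.\<close>

lemma connected_touches_few_cells:
  assumes C: "connected C" "C \<subseteq> free (grid h n J)" "C \<subseteq> cball p r"
    and r: "4 * r < h" "0 < r" and M: "\<And>q. q \<in> C \<Longrightarrow> \<bar>snd q\<bar> \<le> M" "M / h + real n \<le> of_int J"
  shows "card {ob \<in> grid h n J. \<exists>q\<in>C. q \<in> rect ob} \<le> 6"
proof (cases "{ob \<in> grid h n J. \<exists>q\<in>C. q \<in> rect ob} = {}")
  case False
  have h: "h > 0" using r by linarith
  define X where "X = {c. c < n \<and> (\<exists>q\<in>C. real c \<le> fst q \<and> fst q \<le> real c + 1)}"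
  have "X \<noteq> {}" using False h by (fastforce simp: X_def grid_def rect_cell)
  define a where "a = (LEAST c. c \<in> X)"
  have a: "a \<in> X" "\<And>c. c \<in> X \<Longrightarrow> a \<le> c"
    unfolding a_def using \<open>X \<noteq> {}\<close> by (auto intro: LeastI Least_le)
  have close: "\<bar>snd q - snd p\<bar> \<le> r" if "q \<in> C" for q
    using C(3) that dist_snd_le[of q p] by (auto simp: dist_real_def dist_commute)
  have X: "c \<in> {a, a + 1, a + 2}" if "c \<in> X" for c
  proof (rule ccontr)
    assume "\<not> ?thesis"
    with a(2)[OF that] have c: "a + 3 \<le> c" by auto
    obtain q1 where q1: "q1 \<in> C" "fst q1 \<le> real a + 1" using a(1) by (auto simp: X_def)
    obtain q2 where q2: "q2 \<in> C" "real c \<le> fst q2" "c < n" using \<open>c \<in> X\<close> unfolding X_def by blast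
    have "connected (fst ` C)"
      by (intro connected_continuous_image C continuous_intros)
    then have ivt: "x \<in> fst ` C" if "fst q1 \<le> x" "x \<le> fst q2" for x
      using q1 q2 that by (meson connectedD_interval imageI)
    \<comment> \<open>These are the midlines of the columns \<open>a + 1\<close> and
      \<open>a + 2\<close>, both lying between \<open>q1\<close> and \<open>q2\<close>.\<close>
    have "real a + 3/2 \<in> fst ` C" "real a + 5/2 \<in> fst ` C"
      using q1 q2 c by (auto intro!: ivt)
    then obtain u v where uv: "u \<in> C" "fst u = real a + 3/2" "v \<in> C" "fst v = real a + 5/2"
      unfolding image_iff by metis
    have "h / 2 \<le> \<bar>snd u - snd v\<bar>"
      by (rule free_grid_adjacent_columns[where c = "a + 1" and d = "a + 2" and M = M and n = n and J = J])
        (use uv c q2 h M(1)[OF uv(1)] M(1)[OF uv(3)] M(2) subsetD[OF C(2)] in simp_all)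
    with close[OF uv(1)] close[OF uv(3)] r show False by linarith
  qed
  \<comment> \<open>The lowest index in column \<open>c\<close> of a cell whose top edge is not
    below \<open>snd p - r\<close>; only this cell and the next one up can be touched.\<close>
  define b where "b c = \<lceil>(snd p - r) / h - real c / 2 - 1\<rceil>" for c :: nat
  have "{ob \<in> grid h n J. \<exists>q\<in>C. q \<in> rect ob}
      \<subseteq> (\<lambda>(c, i). cell h c (b c + i)) ` ({a, a + 1, a + 2} \<times> {0, 1})"
  proof clarify
    fix x1 x2 y1 y2 q assume ob: "(x1, x2, y1, y2) \<in> grid h n J" "q \<in> C" "q \<in> rect (x1, x2, y1, y2)"
    then obtain c j where cj: "(x1, x2, y1, y2) = cell h c j" "c < n" by (auto simp: grid_def)
    have q: "real c \<le> fst q" "fst q \<le> real c + 1" "of_int j \<le> snd q / h - real c / 2"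
       "snd q / h - real c / 2 \<le> of_int j + 1"
      using ob(3) unfolding cj rect_cell[OF h] by auto
    have "(snd p - r) / h \<le> snd q / h" "snd q / h \<le> (snd p + r) / h"
      using close[OF ob(2)] h by (auto intro!: divide_right_mono)
    moreover have "(snd p + r) / h < (snd p - r) / h + 1"
      using h r by (simp add: field_simps)
    ultimately have "j = b c \<or> j = b c + 1" using q(3,4) unfolding b_def by linarith
    moreover have "c \<in> {a, a + 1, a + 2}" using X q ob(2) cj(2) by (auto simp: X_def)
    ultimately have "cell h c j \<in> (\<lambda>(c, i). cell h c (b c + i)) ` ({a, a + 1, a + 2} \<times> {0, 1})"
      by (intro image_eqI[of _ _ "(c, j - b c)"]) auto
    then show "(x1, x2, y1, y2) \<in> (\<lambda>(c, i). cell h c (b c + i)) ` ({a, a + 1, a + 2} \<times> {0, 1})"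
      by (simp only: cj)
  qed
  then have "card {ob \<in> grid h n J. \<exists>q\<in>C. q \<in> rect ob}
     \<le> card ((\<lambda>(c, i). cell h c (b c + i)) ` ({a, a + 1, a + 2} \<times> {0, 1}))"
    by (intro card_mono) auto
  also have "\<dots> \<le> card ({a, a + 1, a + 2} \<times> {0, 1::int})" by (intro card_image_le) auto
  also have "\<dots> \<le> 6" by (simp add: card_cartesian_product)
  finally show ?thesis .
next
  case True
  then show ?thesis by (simp only: card.empty)
qed

section \<open>Running the robot on the wall\<close>

text \<open>The time set is arbitrary because a robot that never leaves some ball is observed over
  all of \<open>{0..}\<close>.\<close>

definition touched :: "scene \<Rightarrow> (real \<Rightarrow> point) \<Rightarrow> real set \<Rightarrow> scene" where
  "touched S g I = {ob \<in> S. \<exists>t\<in>I. g t \<in> rect ob}"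

lemma touched_Un: "touched S g (I \<union> I') = touched S g I \<union> touched S g I'"
  by (auto simp: touched_def)

text \<open>The times at distance exactly \<open>r\<close> form a nonempty closed set bounded below,
  and \<open>T'\<close> is its least element. By the intermediate value theorem the distance cannot
  exceed \<open>r\<close> before.\<close>

lemma first_exit_from_ball:
  fixes g :: "real \<Rightarrow> point"
  assumes "continuous_on {0..} g" "0 \<le> T" "T \<le> t" "r < dist (g T) (g t)" "0 < r"
  obtains T' where "T \<le> T'" "dist (g T) (g T') = r" "g ` {T..T'} \<subseteq> cball (g T) r"
proof -
  define A where "A = {s \<in> {T..t}. dist (g T) (g s) = r}"
  have cont: "continuous_on {a..b} (\<lambda>s. dist (g T) (g s))" if "0 \<le> a" for a b
    by (intro continuous_intros continuous_on_subset[OF assms(1)]) (use that in auto)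
  have ivt: "\<exists>s\<in>A. s \<le> u" if "T \<le> u" "u \<le> t" "r < dist (g T) (g u)" for u
    using IVT'[of "\<lambda>s. dist (g T) (g s)" T r u] that assms cont[of T u]
    by (auto simp: A_def)
  have "closed A"
  proof -
    have "closed ({T..t} \<inter> (\<lambda>s. dist (g T) (g s)) -` {r})"
      using cont[OF assms(2)] by (intro continuous_closed_preimage) auto
    moreover have "{T..t} \<inter> (\<lambda>s. dist (g T) (g s)) -` {r} = A" by (auto simp: A_def)
    ultimately show ?thesis by simp
  qed
  moreover have bdd: "bdd_below A" by (auto simp: A_def)
  moreover have "A \<noteq> {}" using ivt[of t] assms by auto
  ultimately have inf: "Inf A \<in> A" by (intro closed_contains_Inf)
  have "dist (g T) (g s) \<le> r" if s: "T \<le> s" "s \<le> Inf A" for s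
  proof (rule ccontr)
    assume "\<not> ?thesis"
    then obtain s' where "s' \<in> A" "s' \<le> s" using ivt[of s] s inf by (auto simp: A_def)
    moreover from this have "Inf A \<le> s'" using bdd by (intro cInf_lower)
    ultimately have "s = Inf A" using s by linarith
    with inf \<open>\<not> ?thesis\<close> show False by (auto simp: A_def)
  qed
  with inf show thesis by (intro that[of "Inf A"]) (auto simp: A_def)
qed

text \<open>The run is cut into legs, each ending on first reaching distance \<open>r\<close> from
  its start. A leg adds \<open>r\<close> to the polygonal length and at most six cells. Either
  \<open>K\<close> legs are completed, or some leg never ends and counts as one last piece.
  \<open>N\<close> fixes in advance one height bound \<open>M\<close> for the whole
  induction.\<close>

lemma exploration_of_grid:
  assumes cont: "continuous_on {0..} g" and free: "\<And>t. 0 \<le> t \<Longrightarrow> g t \<in> free (grid h n J)"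
    and g0: "g 0 = start_point" and r: "4 * r < h" "0 < r"
    and M: "(real N + 1) * r \<le> M" "M / h + real n \<le> of_int J" and "K \<le> N"
  shows "(\<exists>T\<ge>0. polygonal_reach g T (real K * r) \<and> norm (g T) \<le> real K * r \<and>
            (\<forall>t\<in>{0..T}. norm (g t) \<le> (real K + 1) * r) \<and>
            card (touched (grid h n J) g {0..T}) \<le> 6 * (K + 1)) \<or>
         (\<forall>t\<in>{0..}. norm (g t) \<le> (real K + 1) * r) \<and>
            card (touched (grid h n J) g {0..}) \<le> 6 * (K + 1)"
    (is "(\<exists>T\<ge>0. ?P T K) \<or> ?Q K")
  using \<open>K \<le> N\<close>
proof (induction K)
  have norm: "norm (g t) \<le> (real K + 1) * r"
    if "norm p \<le> real K * r" "g ` I \<subseteq> cball p r" "t \<in> I" for I p K t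
  proof -
    have "dist p (g t) \<le> r" using that by auto
    then show ?thesis using that(1) norm_triangle_sub[of "g t" p]
      by (simp add: dist_norm norm_minus_commute algebra_simps)
  qed
  have piece: "card (touched (grid h n J) g I) \<le> 6"
    if "K \<le> N" "norm p \<le> real K * r" "g ` I \<subseteq> cball p r" "connected I" "I \<subseteq> {0..}" for I p K
  proof -
    have "\<bar>snd q\<bar> \<le> M" if "q \<in> g ` I" for q
    proof -
      have "\<bar>snd q\<bar> \<le> norm q" using dist_snd_le[of q 0] by simp
      also have "\<dots> \<le> (real K + 1) * r"
        using norm[OF \<open>norm p \<le> _\<close> \<open>g ` I \<subseteq> _\<close>] that by auto
      also have "\<dots> \<le> (real N + 1) * r" using \<open>K \<le> N\<close> r by (intro mult_right_mono) auto
      finally show ?thesis using M by linarith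
    qed
    moreover have "connected (g ` I)"
      by (intro connected_continuous_image continuous_on_subset[OF cont] that)
    ultimately have "card {ob \<in> grid h n J. \<exists>q\<in>g ` I. q \<in> rect ob} \<le> 6"
      using that free by (intro connected_touches_few_cells[OF _ _ that(3) r _ M(2)]) auto
    then show ?thesis by (simp add: touched_def)
  qed
  {
    case 0
    \<comment> \<open>The single instant \<open>0\<close> is the initial piece; it accounts for the
      \<open>+ 1\<close> in \<open>K + 1\<close>.\<close>
    have "?P 0 0"
      using piece[of 0 "g 0" "{0}"] r g0 by (auto simp: polygonal_reach_0 start_point_def zero_prod_def)
    then show ?case by blast
  next
    case (Suc K)
    consider T where "0 \<le> T" "?P T K" | "?Q K" using Suc by auto
    then show ?case
    proof cases
      case 2
      have "norm (g t) \<le> (real (Suc K) + 1) * r" if "t \<in> {0..}" for t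
        using bspec[OF conjunct1[OF 2] that] r(2) by (simp add: algebra_simps)
      with 2 have "?Q (Suc K)" by auto
      then show ?thesis by blast
    next
      case 1
      have mono: "norm (g t) \<le> (real (Suc K) + 1) * r" if "norm (g t) \<le> (real K + 1) * r" for t
        using that r(2) by (simp add: algebra_simps)
      have extend: "(\<forall>t\<in>{0..T} \<union> I. norm (g t) \<le> (real (Suc K) + 1) * r) \<and>
          card (touched (grid h n J) g ({0..T} \<union> I)) \<le> 6 * (Suc K + 1)"
        if I: "g ` I \<subseteq> cball (g T) r" "connected I" "I \<subseteq> {0..}" for I
      proof -
        have "card (touched (grid h n J) g I) \<le> 6"
          using Suc.prems 1 I by (intro piece[of K "g T"]) auto
        then have "card (touched (grid h n J) g ({0..T} \<union> I)) \<le> 6 * (Suc K + 1)"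
          unfolding touched_Un using 1
            card_Un_le[of "touched (grid h n J) g {0..T}" "touched (grid h n J) g I"] by simp
        moreover have "norm (g t) \<le> (real (Suc K) + 1) * r" if "t \<in> {0..T} \<union> I" for t
          using that 1 norm[of "g T" K I t] I mono by blast
        ultimately show ?thesis by blast
      qed
      show ?thesis
      \<comment> \<open>Either the robot stays in the current ball for ever, or the next leg
        ends.\<close>
      proof (cases "g ` {T..} \<subseteq> cball (g T) r")
        case True
        have "{0..T} \<union> {T..} = {0..}" using 1 by auto
        then have "?Q (Suc K)" using extend[OF True] 1(1) by simp
        then show ?thesis by blast
      next
        case False
        then obtain t where "T \<le> t" "r < dist (g T) (g t)" by (auto simp: image_subset_iff not_le)
        then obtain T' where T': "T \<le> T'" "dist (g T) (g T') = r" "g ` {T..T'} \<subseteq> cball (g T) r"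
          using first_exit_from_ball[OF cont 1(1) _ _ r(2)] by blast
        have T_split: "{0..T} \<union> {T..T'} = {0..T'}" using 1 T' by auto
        have "polygonal_reach g T' (real (Suc K) * r)"
          by (rule polygonal_reach_step[OF conjunct1[OF 1(2)] T'(1)]) (simp add: T'(2) distrib_right)
        moreover have "norm (g T') \<le> real (Suc K) * r"
          using norm[of "g T" K "{T..T'}" T'] 1(2) T'(1,3) by (simp add: add.commute)
        moreover have "{T..T'} \<subseteq> {0..}" using 1 by auto
        moreover note extend[OF T'(3) connected_Icc this, unfolded T_split]
        ultimately have "?P T' (Suc K)" by blast
        moreover have "0 \<le> T'" using 1(1) T'(1) by linarith
        ultimately show ?thesis by blast
      qed
    qed
  }
qed

text \<open>The map \<open>\<phi>\<close> measures progress in x; its two forms are the outward and the return trip.\<close>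

lemma polygonal_reach_crossing:
  fixes \<phi> :: "real \<Rightarrow> real"
  assumes cont: "continuous_on {a..b} g" and "a \<le> b" "polygonal_reach g a v"
    and free: "\<And>t. t \<in> {a..b} \<Longrightarrow> g t \<in> free (grid h n J)"
    and M: "\<And>t. t \<in> {a..b} \<Longrightarrow> \<bar>snd (g t)\<bar> \<le> M" "M / h + real n \<le> of_int J" and h: "h > 0"
    and \<phi>: "\<phi> = (\<lambda>x. x) \<or> \<phi> = (\<lambda>x. real n - x)"
    and ends: "\<phi> (fst (g a)) = 0" "\<phi> (fst (g b)) = real n" and "n > 0"
  shows "polygonal_reach g b (v + 1 + (real n - 1) * h / 2)"
proof -
  have \<phi>_dist: "\<bar>\<phi> (fst p) - \<phi> (fst q)\<bar> \<le> dist p q" for p q :: point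
    using \<phi> dist_fst_le[of p q] by (auto simp: dist_real_def)
  have ivt: "\<exists>s'\<in>{s..b}. \<phi> (fst (g s')) = y" if "s \<in> {a..b}" "\<phi> (fst (g s)) \<le> y" "y \<le> real n" for s y
  proof -
    have "continuous_on {s..b} (\<lambda>t. \<phi> (fst (g t)))"
      using \<phi> that by (auto intro!: continuous_intros continuous_on_subset[OF cont])
    then show ?thesis using IVT'[of "\<lambda>t. \<phi> (fst (g t))" s y b] that ends by auto
  qed
  \<comment> \<open>Sampled at the column midlines, the crossing consists of \<open>n - 1\<close>
    changes of column costing at least \<open>h / 2\<close> each and two half columns costing at
    least \<open>1/2\<close> each.\<close>
  have "\<exists>s\<in>{a..b}. \<phi> (fst (g s)) = real c + 1/2 \<and> polygonal_reach g s (v + 1/2 + real c * h / 2)"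
    if "c < n" for c
    using that
  proof (induction c)
    case 0
    then obtain s where s: "s \<in> {a..b}" "\<phi> (fst (g s)) = 1/2"
      using ivt[of a "1/2"] \<open>a \<le> b\<close> ends by auto
    then have "polygonal_reach g s (v + 1/2)"
      using \<phi>_dist[of "g a" "g s"] ends by (intro polygonal_reach_step[OF assms(3)]) auto
    with s show ?case by (intro bexI[of _ s]) auto
  next
    case (Suc c)
    then obtain s where s: "s \<in> {a..b}" "\<phi> (fst (g s)) = real c + 1/2"
      "polygonal_reach g s (v + 1/2 + real c * h / 2)" by auto
    obtain s' where s': "s' \<in> {s..b}" "\<phi> (fst (g s')) = real (Suc c) + 1/2"
      using ivt[OF s(1), of "real (Suc c) + 1/2"] s Suc by auto
    \<comment> \<open>On the return trip the columns are met in reverse order.\<close>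
    define col where "col i = (if \<phi> = (\<lambda>x. x) then i else n - 1 - i)" for i
    have col: "real (col i) < x \<and> x < real (col i) + 1" if "\<phi> x = real i + 1/2" "i < n" for x i
      using that \<phi> by (auto simp: col_def of_nat_diff)
    have "s' \<in> {a..b}" using s s' by auto
    have "h / 2 \<le> \<bar>snd (g s) - snd (g s')\<bar>"
    proof (rule free_grid_adjacent_columns[where c = "col c" and d = "col (Suc c)" and M = M and n = n and J = J])
      show "col c = Suc (col (Suc c)) \<or> col (Suc c) = Suc (col c)" "col c < n" "col (Suc c) < n"
        using Suc.prems by (auto simp: col_def)
    qed (use col[OF s(2)] col[OF s'(2)] free M h s(1) \<open>s' \<in> {a..b}\<close> Suc.prems in auto)
    also have "\<dots> \<le> dist (g s) (g s')"
      using dist_snd_le[of "g s" "g s'"] by (simp add: dist_real_def)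
    finally have "polygonal_reach g s' (v + 1/2 + real (Suc c) * h / 2)"
      using s' by (intro polygonal_reach_step[OF s(3)]) (auto simp: field_simps)
    with s' \<open>s' \<in> {a..b}\<close> show ?case by blast
  qed
  from this[of "n - 1"] obtain s where s: "s \<in> {a..b}" "\<phi> (fst (g s)) = real (n - 1) + 1/2"
    "polygonal_reach g s (v + 1/2 + real (n - 1) * h / 2)" using \<open>n > 0\<close> by auto
  show ?thesis
    using s \<phi>_dist[of "g s" "g b"] ends \<open>n > 0\<close>
    by (intro polygonal_reach_step[OF s(3)]) (auto simp: of_nat_diff)
qed

text \<open>The goal is closed and \<open>g\<close> is continuous, so the infimum in
  \<open>trip_end\<close> is attained.\<close>

lemma trip_end_goal:
  assumes "continuous_on {0..} g" "trip_end n g i = Some a" "0 \<le> a" "trip_end n g (Suc i) = Some b"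
  shows "a \<le> b" "g b \<in> trip_goal n (Suc i)"
proof -
  define A where "A = {t. t \<ge> a \<and> g t \<in> trip_goal n (Suc i)}"
  have A: "A \<noteq> {}" "b = Inf A" using assms(2,4) by (auto simp: A_def split: if_splits)
  have "closed (trip_goal n (Suc i))"
    by (auto simp: trip_goal_def intro!: closed_Collect_eq continuous_intros)
  moreover have "continuous_on {a..} g"
    using assms(1,3) by (auto elim!: continuous_on_subset)
  ultimately have "closed ({a..} \<inter> g -` trip_goal n (Suc i))"
    by (intro continuous_closed_preimage) auto
  moreover have "{a..} \<inter> g -` trip_goal n (Suc i) = A" by (auto simp: A_def)
  ultimately have "closed A" by simp
  moreover have "bdd_below A" by (auto simp: A_def)
  ultimately have "b \<in> A" using A closed_contains_Inf by auto
  then show "a \<le> b" "g b \<in> trip_goal n (Suc i)" by (auto simp: A_def)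
qed

text \<open>Each trip starts where the previous one ended and crosses all columns in one direction
  or the other, so the bounds of \<open>polygonal_reach_crossing\<close> add up.\<close>

lemma polygonal_reach_trips:
  assumes cont: "continuous_on {0..} g" and g0: "g 0 = start_point"
    and "trip_end n g i = Some b"
    and free: "\<And>t. t \<in> {0..b} \<Longrightarrow> g t \<in> free (grid h n J)"
    and M: "\<And>t. t \<in> {0..b} \<Longrightarrow> \<bar>snd (g t)\<bar> \<le> M" "M / h + real n \<le> of_int J" and h: "h > 0"
    and "n > 0"
  shows "0 \<le> b \<and> (i > 0 \<longrightarrow> g b \<in> trip_goal n i) \<and>
    polygonal_reach g b (real i * (1 + (real n - 1) * h / 2))"
  using assms(3) free M(1)
proof (induction i arbitrary: b)
  case 0
  then show ?case by (auto simp: polygonal_reach_0)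
next
  case (Suc i)
  then obtain a where a: "trip_end n g i = Some a" by (auto split: option.splits)
  \<comment> \<open>This takes a separate induction: the outer induction hypothesis needs
    \<open>a \<le> b\<close>, which itself rests on \<open>0 \<le> a\<close>.\<close>
  have "0 \<le> a" using a
  proof (induction i arbitrary: a)
    case (Suc i)
    then obtain a' where "trip_end n g i = Some a'" by (auto split: option.splits)
    with Suc trip_end_goal(1)[OF cont] show ?case by (meson order_trans)
  qed simp
  note ab = trip_end_goal[OF cont a this Suc.prems(1)]
  have IH: "i > 0 \<longrightarrow> g a \<in> trip_goal n i" "polygonal_reach g a (real i * (1 + (real n - 1) * h / 2))"
    using Suc.IH[OF a] Suc.prems ab \<open>0 \<le> a\<close> by auto
  \<comment> \<open>Trip \<open>Suc i\<close> goes outward exactly for even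
    \<open>i\<close>.\<close>
  define \<phi> where "\<phi> = (if even i then (\<lambda>x. x) else (\<lambda>x. real n - x))"
  have "polygonal_reach g b (real i * (1 + (real n - 1) * h / 2) + 1 + (real n - 1) * h / 2)"
  proof (rule polygonal_reach_crossing[OF _ ab(1) IH(2) _ _ M(2) h, where \<phi> = \<phi>])
    show "continuous_on {a..b} g" using \<open>0 \<le> a\<close> by (auto intro: continuous_on_subset[OF cont])
    show "\<phi> = (\<lambda>x. x) \<or> \<phi> = (\<lambda>x. real n - x)" by (simp add: \<phi>_def)
    have "a = 0" if "i = 0" using that a by simp
    then show "\<phi> (fst (g a)) = 0"
      using IH(1) g0 by (cases "i = 0") (auto simp: \<phi>_def trip_goal_def start_point_def)
    show "\<phi> (fst (g b)) = real n" using ab(2) by (auto simp: \<phi>_def trip_goal_def start_point_def)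
  qed (use Suc.prems \<open>0 \<le> a\<close> \<open>n > 0\<close> in auto)
  moreover have "real i * (1 + (real n - 1) * h / 2) + 1 + (real n - 1) * h / 2
      = real (Suc i) * (1 + (real n - 1) * h / 2)"
    by (simp add: field_simps)
  ultimately show ?case using ab \<open>0 \<le> a\<close> by simp
qed

section \<open>A short path past few cells\<close>

text \<open>Levels are spaced by \<open>h\<close>, the height of a cell, so the interior of a cell
  meets at most one of them; averaging over the \<open>m\<close> lowest levels gives the
  bound.\<close>

lemma exists_sparse_level:
  fixes S :: scene
  assumes S: "S \<subseteq> grid h n J" and h: "h > 0" and "m > 0"
  obtains l where "l < m"
    "real (card {ob \<in> S. case ob of (x1, x2, y1, y2) \<Rightarrow> y1 < real l * h \<and> real l * h < y2}) \<le> real (card S) / real m"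
proof -
  define A where "A l = {ob \<in> S. case ob of (x1, x2, y1, y2) \<Rightarrow> y1 < real l * h \<and> real l * h < y2}" for l :: nat
  have fin: "finite S" using S by (rule finite_subset) (simp add: grid_def)
  have disj: "A l \<inter> A l' = {}" if "l \<noteq> l'" for l l'
  proof (rule ccontr)
    assume "\<not> ?thesis"
    then obtain ob where "ob \<in> S" "ob \<in> A l" "ob \<in> A l'" by (auto simp: A_def)
    then obtain c j where "cell h c j \<in> A l" "cell h c j \<in> A l'" using S by (auto simp: grid_def)
    then have "of_int j + real c / 2 < real l" "real l < of_int j + 1 + real c / 2"
      "of_int j + real c / 2 < real l'" "real l' < of_int j + 1 + real c / 2"
      using h by (auto simp: A_def cell_def)
    then have "l = l'" by linarith
    with that show False by simp
  qed
  have "(\<Sum>l<m. card (A l)) = card (\<Union>l<m. A l)"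
    using fin disj by (subst card_UN_disjoint) (auto simp: A_def)
  also have "\<dots> \<le> card S" using fin by (intro card_mono) (auto simp: A_def)
  finally have le: "(\<Sum>l<m. card (A l)) \<le> card S" .
  have "\<exists>l<m. real (card (A l)) \<le> real (card S) / real m"
  proof (rule ccontr)
    assume "\<not> ?thesis"
    then have "(\<Sum>l<m. real (card S) / real m) < (\<Sum>l<m. real (card (A l)))"
      using \<open>m > 0\<close> by (intro sum_strict_mono) auto
    also have "\<dots> \<le> real (card S)" using le by (simp flip: of_nat_sum)
    finally show False using \<open>m > 0\<close> by simp
  qed
  then show thesis using that unfolding A_def by blast
qed

text \<open>The walk follows the level column by column. A blocking cell is bypassed by climbing
  \<open>h / 2\<close> on the column boundary, crossing along the top edge of the cell and
  descending again, so it costs an extra \<open>h\<close>.\<close>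

lemma walk_along_level:
  fixes S :: scene and l :: nat
  assumes S: "S \<subseteq> grid h n J" and h: "h > 0"
  defines "A \<equiv> {ob \<in> S. case ob of (x1, x2, y1, y2) \<Rightarrow> y1 < real l * h \<and> real l * h < y2}"
  shows "walk S (0, real l * h) (real c, real l * h) (real c + h * real (card {ob \<in> A. fst ob < real c}))"
proof (induction c)
  have free: "(x, y) \<in> free S" if "\<And>c j. cell h c j \<in> S \<Longrightarrow> (x, y) \<notin> rect_int (cell h c j)" for x y
    using that S by (force simp: free_def grid_def)
  have finA: "finite A"
    unfolding A_def by (rule finite_subset[of _ "grid h n J"]) (use S in \<open>auto simp: grid_def\<close>)
  have vertical: "walk S (real c, y) (real c, y') \<bar>y - y'\<bar>" for c :: nat and y y'
  proof (rule walk_segment)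
    \<comment> \<open>Vertical lines at integer abscissae meet no open cell.\<close>
    have "(real c, z) \<in> free S" for z
      using h by (intro free) (auto simp: rect_int_cell)
    then show "closed_segment (real c, y) (real c, y') \<subseteq> free S"
      by (auto dest!: closed_segment_PairD)
  qed (simp add: dist_Pair_Pair dist_real_def)
  have horizontal: "walk S (real c, y) (real (Suc c), y) B"
    if unblocked: "\<And>j. cell h c j \<in> S \<Longrightarrow> \<not> (of_int j < y / h - real c / 2 \<and> y / h - real c / 2 < of_int j + 1)"
      and B: "1 \<le> B" for c y B
  proof (rule walk_segment)
    have "(x, y) \<in> free S" if x: "real c \<le> x" "x \<le> real (Suc c)" for x
    proof (rule free)
      fix c' j assume "cell h c' j \<in> S"
      then show "(x, y) \<notin> rect_int (cell h c' j)"
        using unblocked[of j] x h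
        by (cases "c' = c") (auto simp: rect_int_cell)
    qed
    then show "closed_segment (real c, y) (real (Suc c), y) \<subseteq> free S"
      by (auto dest!: closed_segment_PairD simp: closed_segment_eq_real_ivl)
  qed (use B in \<open>simp add: dist_Pair_Pair dist_real_def\<close>)
  {
    case 0
    have "{ob \<in> A. fst ob < real 0} = {}" using S by (auto simp: A_def grid_def cell_def)
    then show ?case using vertical[of 0 "real l * h" "real l * h"] by (simp only:) simp
  next
    case (Suc c)
    define D where "D c = {ob \<in> A. fst ob < real c}" for c
    have D_mono: "D c \<subseteq> D (Suc c)" by (auto simp: D_def)
    have finD: "finite (D c)" for c using finA by (auto simp: D_def)
    have in_A: "cell h c j \<in> A \<longleftrightarrow>
        cell h c j \<in> S \<and> of_int j < real l - real c / 2 \<and> real l - real c / 2 < of_int j + 1" for j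
      using h by (auto simp: A_def cell_def)
    show ?case
    proof (cases "\<exists>j. cell h c j \<in> A")
      case False
      have "real (card (D c)) \<le> real (card (D (Suc c)))"
        using D_mono finD by (simp add: card_mono)
      then have "walk S (real c, real l * h) (real (Suc c), real l * h)
          (1 + h * (real (card (D (Suc c))) - real (card (D c))))"
        using False in_A h by (intro horizontal) auto
      from walk_trans[OF Suc this[unfolded D_def]] show ?thesis
        by (simp add: algebra_simps)
    next
      case True
      then obtain j where j: "cell h c j \<in> A" by blast
      then have "2 * int l = 2 * j + int c + 1" using in_A by auto
      then have lj: "2 * real l = 2 * of_int j + real c + 1" by linarith
      \<comment> \<open>A cell blocking level l has that level as its midline, so its top edge is a crevice at
        height h/2 above.\<close>
      define y where "y = real l * h + h / 2"
      have "y / h - real c / 2 = of_int (j + 1)" using h lj by (simp add: y_def field_simps)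
      moreover have "cell h c j \<in> D (Suc c)" "cell h c j \<notin> D c" using j by (auto simp: D_def cell_def)
      then have "card (D c) < card (D (Suc c))" using D_mono finD by (intro psubset_card_mono) auto
      then have "real (card (D c)) + 1 \<le> real (card (D (Suc c)))" by linarith
      then have "h * 1 \<le> h * (real (card (D (Suc c))) - real (card (D c)))"
        using h by (intro mult_left_mono) auto
      \<comment> \<open>The horizontal part may use what remains of the budget after spending
        \<open>h\<close> on the climb and the descent; at least the width 1 remains.\<close>
      ultimately have "walk S (real c, y) (real (Suc c), y)
          (1 + h * (real (card (D (Suc c))) - real (card (D c))) - h)"
        by (intro horizontal) auto
      from walk_trans[OF walk_trans[OF walk_trans[OF Suc vertical[of c "real l * h" y]] this]
          vertical[of "Suc c" y "real l * h"]]
      show ?thesis using h by (simp add: D_def y_def algebra_simps)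
    qed
  }
qed

text \<open>The three terms pay for the climb along the line x = 0 to a sparse level below
  \<open>m\<close>, for the width \<open>n\<close>, and for the detours.\<close>

lemma shortest_le_sparse_scene:
  assumes S: "S \<subseteq> grid h n J" and h: "h > 0" and "m > 0"
  shows "shortest n S \<le> ereal (real m * h + real n + h * (real (card S) / real m))"
proof -
  define A where "A l = {ob \<in> S. case ob of (x1, x2, y1, y2) \<Rightarrow> y1 < real l * h \<and> real l * h < y2}" for l :: nat
  obtain l where l: "l < m" "real (card (A l)) \<le> real (card S) / real m"
    unfolding A_def by (rule exists_sparse_level[OF assms])
  have "(0, z) \<in> free S" for z
    using S h by (fastforce simp: free_def grid_def rect_int_cell)
  then have "walk S (0, 0) (0, real l * h) (real l * h)"
    using h by (intro walk_segment) (auto dest!: closed_segment_PairD simp: dist_Pair_Pair dist_real_def)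
  from walk_trans[OF this walk_along_level[OF S h, of l n]]
  have "shortest n S \<le> ereal (real l * h + (real n + h * real (card {ob \<in> A l. fst ob < real n})))"
    unfolding A_def start_point_def[symmetric] by (rule shortest_le_walk) simp
  also have "\<dots> \<le> ereal (real m * h + real n + h * (real (card S) / real m))"
  proof -
    have "finite (A l)"
      unfolding A_def by (rule finite_subset[of _ "grid h n J"]) (use S in \<open>auto simp: grid_def\<close>)
    then have "card {ob \<in> A l. fst ob < real n} \<le> card (A l)" by (intro card_mono) auto
    then have "h * real (card {ob \<in> A l. fst ob < real n}) \<le> h * (real (card S) / real m)"
      using h l(2) by (intro mult_left_mono) linarith+
    moreover have "real l * h \<le> real m * h" using l h by (intro mult_right_mono) auto
    ultimately show ?thesis by simp
  qed
  finally show ?thesis .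
qed

section \<open>The lower bound\<close>

text \<open>Every obstacle in contact at a time in \<open>I\<close> is kept, so deleting the others
  goes unnoticed at these times.\<close>

lemma obs_touched:
  assumes "t \<in> I"
  shows "obs (touched S g I) (g t) = obs S (g t)"
  unfolding obs_def touched_def using assms by (intro arg_cong[of _ _ "image _"]) auto

lemma strategyD:
  assumes "strategy n R" "S \<in> scenes n"
  shows "continuous_on {0..} (R S)" "R S 0 = start_point" "0 \<le> t \<Longrightarrow> R S t \<in> free S"
  using assms unfolding strategy_def by blast+

lemma strategy_nonanticipating:
  assumes "strategy n R" "S \<in> scenes n" "S' \<in> scenes n" "0 \<le> t"
    and "\<And>\<tau>. \<tau> \<in> {0..t} \<Longrightarrow> obs S (R S \<tau>) = obs S' (R S \<tau>)"
  shows "R S' t = R S t"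
proof -
  have "\<forall>\<tau>\<in>{0..t}. R S' \<tau> = R S \<tau>"
    using assms unfolding strategy_def by blast
  then show ?thesis using assms(4) by (metis atLeastAtMost_iff order_refl)
qed

text \<open>If all \<open>k\<close> trips end within the time set \<open>I\<close>, the path is also
  a path through the full wall and pays for every crossing. Otherwise the robot has already
  completed \<open>n * k\<close> legs of displacement \<open>h / 5\<close>. If some trip never ends,
  the cost is infinite.\<close>

lemma strategy_adversarial_scene:
  assumes R: "strategy n R" and h: "1 \<le> h" "h \<le> real n" and k: "1 \<le> k" and n: "0 < n"
  obtains S J where "S \<in> scenes n" "S \<subseteq> grid h n J" "card S \<le> 6 * (n * k + 1)"
    "ereal (real (n * k) * (h / 5)) \<le> cum_cost n R k S"
proof -
  define K where "K = n * k"
  \<comment> \<open>The exploration needs \<open>4 * r < h\<close>; \<open>h / 5\<close> is a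
    convenient choice.\<close>
  define r where "r = h / 5"
  define M where "M = (real K + 1) * r"
  define J where "J = \<lceil>M / h + real n\<rceil>"
  define F where "F = grid h n J"
  define g where "g = R F"
  have r: "4 * r < h" "0 < r" using h by (auto simp: r_def)
  have J: "M / h + real n \<le> of_int J" by (simp add: J_def)
  have F: "F \<in> scenes n" unfolding F_def by (rule grid_in_scenes) fact
  have g: "continuous_on {0..} g" "g 0 = start_point" "\<And>t. 0 \<le> t \<Longrightarrow> g t \<in> free F"
    using strategyD[OF R F] unfolding g_def by blast+
  obtain I where I: "I = {0..} \<or> (\<exists>T\<ge>0. I = {0..T} \<and> polygonal_reach g T (real K * r))"
    and M: "\<And>t. t \<in> I \<Longrightarrow> norm (g t) \<le> M" and card: "card (touched F g I) \<le> 6 * (K + 1)"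
  proof -
    note explore = exploration_of_grid[OF g(1) g(3)[unfolded F_def] g(2) r
        order_refl[of "(real K + 1) * r"] J[unfolded M_def] order_refl, folded F_def M_def]
    from explore show thesis
    proof
      assume "\<exists>T\<ge>0. polygonal_reach g T (real K * r) \<and> norm (g T) \<le> real K * r \<and>
        (\<forall>t\<in>{0..T}. norm (g t) \<le> M) \<and> card (touched F g {0..T}) \<le> 6 * (K + 1)"
      then obtain T where "T \<ge> 0" "polygonal_reach g T (real K * r)"
        "\<forall>t\<in>{0..T}. norm (g t) \<le> M" "card (touched F g {0..T}) \<le> 6 * (K + 1)" by blast
      then show thesis by (intro that[of "{0..T}"]) auto
    next
      assume "(\<forall>t\<in>{0..}. norm (g t) \<le> M) \<and> card (touched F g {0..}) \<le> 6 * (K + 1)"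
      then show thesis by (intro that[of "{0..}"]) auto
    qed
  qed
  define S where "S = touched F g I"
  have "S \<subseteq> F" by (auto simp: S_def touched_def)
  then have S: "S \<in> scenes n" using F scenes_subset by blast
  have agree: "R S t = g t" if "t \<in> I" for t
  proof -
    have t: "0 \<le> t" "{0..t} \<subseteq> I" using I that by auto
    then have "\<forall>\<tau>\<in>{0..t}. obs F (R F \<tau>) = obs S (R F \<tau>)"
      using obs_touched[of _ I F g] by (auto simp: S_def g_def)
    then show ?thesis
      unfolding g_def using t(1) by (intro strategy_nonanticipating[OF R F S]) auto
  qed
  have contS: "continuous_on {0..} (R S)" and startS: "R S 0 = start_point"
    using strategyD[OF R S] by blast+
  have "ereal (real K * r) \<le> cum_cost n R k S"
  proof (cases "trip_end n (R S) k")
    case None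
    then show ?thesis by (simp add: cum_cost_def)
  next
    case (Some b)
    have "\<exists>v\<ge>real K * r. polygonal_reach (R S) b v"
    proof (cases "{0..b} \<subseteq> I")
      case True
      have "\<bar>snd (R S t)\<bar> \<le> M" if "t \<in> {0..b}" for t
        using that True M[of t] agree[of t] dist_snd_le[of "g t" 0] by fastforce
      \<comment> \<open>The path in \<open>S\<close> avoids even the deleted cells, since up to time
        \<open>b\<close> it is the run on the full wall.\<close>
      moreover have "R S t \<in> free (grid h n J)" if "t \<in> {0..b}" for t
        using that True agree[of t] g(3)[of t] unfolding F_def by auto
      ultimately have "polygonal_reach (R S) b (real k * (1 + (real n - 1) * h / 2))"
        using polygonal_reach_trips[OF contS startS Some _ _ J _ n] h by auto
      \<comment> \<open>For \<open>n = 1\<close> the hypothesis \<open>h \<le> real n\<close> gives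
        \<open>h \<le> 1\<close>; for larger \<open>n\<close>, \<open>n - 1\<close> is at least half
        of \<open>n\<close>.\<close>
      moreover have "real n * h / 5 \<le> 1 + (real n - 1) * h / 2"
      proof (cases "n = 1")
        case True
        then show ?thesis using h by simp
      next
        case False
        then have "2 * h \<le> real n * h" using h n by (intro mult_right_mono) auto
        moreover have "1 + (real n - 1) * h / 2 = 1 + real n * h / 2 - h / 2" by (simp add: field_simps)
        ultimately show ?thesis using h by linarith
      qed
      then have "real K * r \<le> real k * (1 + (real n - 1) * h / 2)"
        using mult_left_mono[of "real n * h / 5" "1 + (real n - 1) * h / 2" "real k"]
        by (simp add: K_def r_def mult_ac)
      ultimately show ?thesis by blast
    next
      case False
      then obtain T where T: "I = {0..T}" "polygonal_reach g T (real K * r)" "T \<le> b"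
        using I by auto
      then have "polygonal_reach (R S) T (real K * r)"
        using agree by (intro polygonal_reach_cong[OF T(2)]) auto
      from polygonal_reach_step[OF this T(3), of "real K * r"] show ?thesis by auto
    qed
    then obtain v where "v \<ge> real K * r" "polygonal_reach (R S) b v" by blast
    then show ?thesis
      using Some polygonal_reach_curve_length[of "R S" b v] order_trans[of "ereal (real K * r)" "ereal v"]
      by (simp add: cum_cost_def)
  qed
  then show thesis
    using that[OF S \<open>S \<subseteq> F\<close>[unfolded F_def]] card by (simp add: S_def K_def r_def)
qed

theorem theorem1:
  "\<exists>c::real. c > 0 \<and> (\<forall>n k R. 1 \<le> k \<longrightarrow> k \<le> n \<longrightarrow> strategy n R \<longrightarrow>
      ereal (c * sqrt (real n / real k)) \<le> comp_ratio R n k)"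
\<comment> \<open>The robot pays at least \<open>n * k * h / 5\<close>, while the shortest path has
  length at most \<open>15 * n\<close>; the quotient gives \<open>1/75\<close>.\<close>
proof (intro exI[of _ "1/75"] conjI allI impI)
  fix n k :: nat and R
  assume k: "1 \<le> k" "k \<le> n" and R: "strategy n R"
  define h where "h = sqrt (real n / real k)"
  \<comment> \<open>About \<open>q\<close> levels balance the climb \<open>m * h\<close> against the
    detours \<open>h * card S / m\<close>: both are of order \<open>h * q = n\<close>.\<close>
  define q where "q = sqrt (real n * real k)"
  define m where "m = nat \<lceil>q\<rceil>"
  have h1: "1 \<le> h" using k by (simp add: h_def)
  have "real n / real k \<le> (real n)\<^sup>2"
  proof -
    have "real n / real k \<le> real n" using k by (simp add: divide_le_eq mult_le_cancel_left1)
    also have "\<dots> \<le> (real n)\<^sup>2" using k by (simp add: power2_eq_square mult_le_cancel_left1)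
    finally show ?thesis .
  qed
  then have hn: "h \<le> real n" unfolding h_def by (rule real_le_lsqrt[rotated]) simp
  obtain S J where S: "S \<in> scenes n" "S \<subseteq> grid h n J" "card S \<le> 6 * (n * k + 1)"
    "ereal (real (n * k) * (h / 5)) \<le> cum_cost n R k S"
    using strategy_adversarial_scene[OF R h1 hn k(1)] k by auto
  have "1 \<le> real n * real k" using k by (simp flip: of_nat_mult)
  then have q1: "1 \<le> q" by (simp add: q_def)
  have m: "q \<le> real m" "real m \<le> 2 * q" "0 < m" using q1 by (auto simp: m_def) linarith+
  have hq: "h * q = real n" using k by (simp add: h_def q_def flip: real_sqrt_mult)
  have qq: "q * q = real n * real k" by (simp add: q_def)
  have "shortest n S \<le> ereal (real m * h + real n + h * (real (card S) / real m))"
    using S(2) h1 m by (intro shortest_le_sparse_scene) auto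
  \<comment> \<open>Here 15 = 2 + 1 + 12 for climb, width and detours. Rounding \<open>q\<close> up
    costs a factor 2 in the climb, and bounding \<open>n * k + 1\<close> by \<open>2 * n * k\<close>
    costs one in the detours.\<close>
  also have "\<dots> \<le> ereal (15 * real n)"
  proof -
    have "real m * h \<le> 2 * q * h" using m h1 by (intro mult_right_mono) auto
    moreover have "h * (real (card S) / real m) \<le> 12 * real n"
    proof -
      have "real (card S) \<le> real (6 * (n * k + 1))" using S(3) by (rule of_nat_mono)
      also have "\<dots> \<le> 12 * (q * q)" using \<open>1 \<le> real n * real k\<close> by (simp add: qq mult.commute)
      finally have "real (card S) / real m \<le> 12 * (q * q) / q"
        using m q1 by (intro frac_le) auto
      then have "real (card S) / real m \<le> 12 * q" using q1 by simp
      then have "h * (real (card S) / real m) \<le> h * (12 * q)" using h1 by (intro mult_left_mono) auto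
      then show ?thesis using hq by simp
    qed
    ultimately show ?thesis using hq by (simp add: mult_ac)
  qed
  finally have short: "shortest n S \<le> ereal (15 * real n)" .
  \<comment> \<open>The cost may be infinite, so the quotients are compared in \<open>ereal\<close>,
    where monotonicity is used for nonnegative arguments.\<close>
  have "0 \<le> ereal (real (n * k) * (h / 5))" using h1 by simp
  then have "0 \<le> cum_cost n R k S" using S(4) by (rule order_trans)
  have "ereal (1 / 75 * h) = ereal (real (n * k) * (h / 5)) / (ereal (real k) * ereal (15 * real n))"
    using k by simp
  also have "\<dots> \<le> cum_cost n R k S / (ereal (real k) * shortest n S)"
    unfolding divide_ereal_def
    using S(4) short shortest_nonneg[of n S] h1 k \<open>0 \<le> cum_cost n R k S\<close>
    by (intro ereal_mult_mono ereal_inverse_antimono ereal_mult_left_mono) (auto simp: ereal_zero_le_0_iff)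
  also have "\<dots> \<le> comp_ratio R n k"
    unfolding comp_ratio_def using S(1) by (intro Sup_upper) blast
  finally show "ereal (1 / 75 * sqrt (real n / real k)) \<le> comp_ratio R n k"
    unfolding h_def .
qed simp

end
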